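(* Let $B \geq 2$ be an integer. Let $k$ and $n$ be two positive integers such that $1 \leq k < Bn-1$ and suppose that $\frac{k}{Bn-1} = 0.\overline{a_1 \dots a_l}_B$, where $l$ is the length of the period of the base-$B$ representation $0.\overline{a_1 \dots a_l}_B$. For any $i \in \{1, \dots, l\}$ let $\tilde{q}_i, \tilde{r}_i$ be the nonnegative integers such that $$B^i \cdot k = \tilde{q}_i (Bn-1) + \tilde{r}_i, \qquad 0 \leq \tilde{r}_i < Bn-1.$$ Then, for any $i \in \{1, \dots, l\}$: (1) $u_B((\tilde{q}_i)_B) = a_i$; (2) $u_B((\tilde{q}_i)_B) = u_B((\tilde{r}_i)_B)$.
   Context: $\mathbf{N}$ denotes the set of nonnegative integers. For a nonnegative integer $d$, $(d)_B$ denotes $d$ represented in base $B$. The map $u_B : \mathbf{N} \to \{0, \dots, B-1\}$ takes any nonnegative integer, represented in base $B$, to its rightmost figure; that is, $u_B((d)_B)$ is the remainder of the Euclidean division of $d$ by $B$. The notation $0.\overline{a_1 \dots a_l}_B$ denotes the purely periodic base-$B$ expansion with figures $a_1, \dots, a_l \in \{0, \dots, B-1\}$ repeated indefinitely in this order. *)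

theory Defs
  imports Complex_Main
begin

text \<open>The rightmost figure of \<open>d\<close> written in base \<open>B\<close>.\<close>

definition u :: "nat \<Rightarrow> nat \<Rightarrow> nat" where
  "u B d = d mod B"

text \<open>The real number \<open>0.a\<^sub>1 a\<^sub>2 \<dots> a\<^sub>l a\<^sub>1 a\<^sub>2 \<dots>\<close> in base \<open>B\<close>. The figures are indexed from 1, and
  the one in position \<open>j + 1\<close> after the point is \<open>a (j mod l + 1)\<close>. That \<open>l > 0\<close> and that the
  figures lie in \<open>{0..<B}\<close> is not built in and has to be assumed separately.\<close>

definition purely_periodic :: "nat \<Rightarrow> nat \<Rightarrow> (nat \<Rightarrow> nat) \<Rightarrow> real" where
  "purely_periodic B l a = (\<Sum>j. real (a (j mod l + 1)) / real B ^ (j + 1))"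

end

theory Submission
  imports Defs
begin

text \<open>Multiplying the expansion by \<open>B ^ i\<close> shifts the point by \<open>i\<close> places, so the quotient
  \<open>q i\<close> is the integer formed by the first \<open>i\<close> figures, provided that the remaining tail is
  smaller than 1. The tail could only equal 1 if all figures were \<open>B - 1\<close>, which periodicity
  would propagate to the whole expansion, contradicting \<open>k < B * n - 1\<close>. Part (2) is
  \<open>B ^ i * k = q i * (B * n - 1) + r i\<close> read modulo \<open>B\<close>.\<close>

text \<open>Arbitrary digit sequences are allowed, indexed from 0, so that every tail of an
  expansion is again a \<open>digit_sum\<close>.\<close>

definition digit_sum :: "nat \<Rightarrow> (nat \<Rightarrow> nat) \<Rightarrow> real" where
  "digit_sum B c = (\<Sum>j. real (c j) / real B ^ (j + 1))"

text \<open>A geometric series of ratio \<open>1 / B\<close>. It serves as the dominating series for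
  convergence and as the extremal value among all expansions.\<close>

lemma sums_max_digits:
  assumes "B \<ge> (2::nat)"
  shows "(\<lambda>j. real (B - 1) / real B ^ (j + 1)) sums 1"
proof -
  have "(\<lambda>j. (real (B - 1) / real B) * (1 / real B) ^ j) sums
      ((real (B - 1) / real B) * (1 / (1 - 1 / real B)))"
    using assms by (intro sums_mult geometric_sums) auto
  moreover have "(real (B - 1) / real B) * (1 / (1 - 1 / real B)) = 1"
    using assms by (simp add: of_nat_diff field_simps)
  ultimately show ?thesis
    by (simp only: power_divide power_one times_divide_times_eq mult_1_right Suc_eq_plus1[symmetric] power_Suc)
qed

lemma summable_digits:
  assumes "B \<ge> (2::nat)" and "\<And>j. c j \<le> B - 1"
  shows "summable (\<lambda>j. real (c j) / real B ^ (j + 1))"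
proof (rule summable_comparison_test'[of _ 0])
  show "summable (\<lambda>j. real (B - 1) / real B ^ (j + 1))"
    using sums_max_digits[OF assms(1)] by (rule sums_summable)
  show "norm (real (c j) / real B ^ (j + 1)) \<le> real (B - 1) / real B ^ (j + 1)" for j
    using assms(2)[of j] by (simp add: divide_right_mono del: of_nat_diff)
qed

lemma digit_sum_nonneg: "B \<ge> 2 \<Longrightarrow> (\<And>j. c j \<le> B - 1) \<Longrightarrow> 0 \<le> digit_sum B c"
  unfolding digit_sum_def by (intro suminf_nonneg summable_digits) auto

text \<open>Subtracting the expansion termwise from the one with all digits \<open>B - 1\<close>,
  whose sum is 1, leaves nonnegative terms, and the term at \<open>m\<close> is positive.\<close>

lemma digit_sum_less_1:
  assumes "B \<ge> 2" and "\<And>j. c j \<le> B - 1" and "c m < B - 1"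
  shows "digit_sum B c < 1"
proof -
  let ?f = "\<lambda>j. real (B - 1) / real B ^ (j + 1)" and ?g = "\<lambda>j. real (c j) / real B ^ (j + 1)"
  have f: "?f sums 1"
    using sums_max_digits[OF assms(1)] .
  have g: "summable ?g"
    using assms(1,2) by (rule summable_digits)
  have "0 < (\<Sum>j. ?f j - ?g j)"
  proof (rule suminf_pos2)
    show "summable (\<lambda>j. ?f j - ?g j)"
      by (intro summable_diff sums_summable[OF f] g)
    show "0 \<le> ?f j - ?g j" for j
      using assms(2)[of j] by (simp add: divide_right_mono del: of_nat_diff)
    show "0 < ?f m - ?g m"
      using assms(1,3) by (simp add: divide_strict_right_mono del: of_nat_diff)
  qed
  also have "\<dots> = 1 - digit_sum B c"
    using suminf_diff[OF sums_summable[OF f] g] sums_unique[OF f] by (simp add: digit_sum_def)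
  finally show ?thesis by simp
qed

lemma digit_sum_shift:
  assumes "B \<ge> 2" and "\<And>j. c j \<le> B - 1"
  shows "real B * digit_sum B c = real (c 0) + digit_sum B (\<lambda>j. c (Suc j))"
proof -
  let ?g = "\<lambda>j. real B * (real (c j) / real B ^ (j + 1))"
  have g: "summable (\<lambda>j. real (c j) / real B ^ (j + 1))"
    using assms by (rule summable_digits)
  have "real B * digit_sum B c = (\<Sum>j. ?g j)"
    unfolding digit_sum_def by (rule suminf_mult[OF g, symmetric])
  also have "\<dots> = (\<Sum>j. ?g (Suc j)) + ?g 0"
    using suminf_split_head[OF summable_mult[OF g, of "real B"]] by simp
  finally show ?thesis
    using assms(1) by (simp add: digit_sum_def)
qed

text \<open>Iterating the one-place shift. The integer part \<open>N\<close> can stay unspecified,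
  because one further shift multiplies it by \<open>B\<close> and it vanishes modulo
  \<open>B\<close>.\<close>

lemma digit_sum_power_shift:
  assumes "B \<ge> 2" and "\<And>j. c j \<le> B - 1"
  shows "\<exists>N::nat. real B ^ i * digit_sum B c = real N + digit_sum B (\<lambda>j. c (i + j))"
proof (induction i)
  case 0
  show ?case by (intro exI[of _ 0]) simp
next
  case (Suc i)
  then obtain N :: nat
    where N: "real B ^ i * digit_sum B c = real N + digit_sum B (\<lambda>j. c (i + j))" by blast
  have "real B ^ Suc i * digit_sum B c = real B * real N + real B * digit_sum B (\<lambda>j. c (i + j))"
    using N by (simp add: algebra_simps)
  also have "\<dots> = real (B * N + c i) + digit_sum B (\<lambda>j. c (Suc i + j))"
    using digit_sum_shift[of B "\<lambda>j. c (i + j)"] assms by simp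
  finally show ?case by blast
qed

lemma nat_part_unique:
  fixes x y :: real
  assumes "real m + x = real n + y" and "0 \<le> x" "x < 1" "0 \<le> y" "y < 1"
  shows "m = n"
  using assms by linarith

theorem theorem5p3:
  fixes B k n l :: nat and a q r :: "nat \<Rightarrow> nat"
  assumes "B \<ge> 2"
    and "n \<ge> 1"
    and "1 \<le> k" and "k < B * n - 1"
    and "l \<ge> 1"
    and "\<forall>i\<in>{1..l}. a i \<in> {0..B - 1}"
    and "real k / real (B * n - 1) = purely_periodic B l a"
    and "\<forall>i\<in>{1..l}. B ^ i * k = q i * (B * n - 1) + r i \<and> 0 \<le> r i \<and> r i < B * n - 1"
  shows "\<forall>i\<in>{1..l}. u B (q i) = a i \<and> u B (q i) = u B (r i)"
proof (intro ballI conjI)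
  fix i assume i: "i \<in> {1..l}"
  define M where "M = B * n - 1"
  define c where "c = (\<lambda>j. a (j mod l + 1))"
  have B: "B \<ge> 2" by fact
  have M: "k < M" "0 < M" "Suc M = B * n"
    using assms(4) by (auto simp: M_def)
  have qr: "B ^ i * k = q i * M + r i" "r i < M"
    using assms(8) i by (auto simp: M_def)
  have c: "c j \<le> B - 1" for j
  proof -
    have "j mod l < l" using assms(5) by simp
    then show ?thesis using assms(6) by (simp add: c_def)
  qed
  have x: "real k / real M = digit_sum B c"
    using assms(7) by (simp add: M_def purely_periodic_def digit_sum_def c_def)
  have "\<exists>m. c m < B - 1"
  proof (rule ccontr)
    assume "\<nexists>m. c m < B - 1"
    then have "c j = B - 1" for j
      using c[of j] by (metis le_neq_implies_less)
    then have "digit_sum B c = 1"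
      using sums_unique[OF sums_max_digits[OF B]] by (simp add: digit_sum_def)
    then show False using x M by simp
  qed
  then obtain m where m: "c m < B - 1" ..
  \<comment> \<open>Moving by \<open>i\<close> whole periods carries the non-maximal digit to a
    position at or beyond \<open>i\<close>, hence into the tail that starts there.\<close>
  have "c (m + l * i) = c m" by (simp add: c_def)
  moreover have "i \<le> m + l * i" using assms(5) by (simp add: trans_le_add2)
  ultimately have m': "c (i + (m + l * i - i)) < B - 1"
    using m by simp
  \<comment> \<open>The last of the \<open>i\<close> shifts is done separately, so that the digit it
    brings before the point appears explicitly next to a multiple of \<open>B\<close>.\<close>
  obtain i' where i': "i = Suc i'"
    using i by (cases i) auto
  obtain N :: nat where N: "real B ^ i' * digit_sum B c = real N + digit_sum B (\<lambda>j. c (i' + j))"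
    using digit_sum_power_shift[of B c i'] B c by blast
  have "real (q i) + real (r i) / real M = real (B ^ i * k) / real M"
    using M qr(1) by (simp add: field_simps)
  also have "\<dots> = real B * (real B ^ i' * digit_sum B c)"
    by (simp add: i' flip: x)
  also have "\<dots> = real B * real N + real B * digit_sum B (\<lambda>j. c (i' + j))"
    unfolding N by (simp add: algebra_simps)
  also have "\<dots> = real (B * N + c i') + digit_sum B (\<lambda>j. c (i + j))"
    using digit_sum_shift[of B "\<lambda>j. c (i' + j)"] B c by (simp add: i')
  \<comment> \<open>Both sides are a natural number plus a fractional part in [0, 1), so the integer
    parts agree.\<close>
  finally have "q i = B * N + c i'"
  proof (rule nat_part_unique)
    show "real (r i) / real M < 1" using M qr(2) by simp
    show "0 \<le> digit_sum B (\<lambda>j. c (i + j))" using B c by (rule digit_sum_nonneg)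
    show "digit_sum B (\<lambda>j. c (i + j)) < 1" using B c m' by (rule digit_sum_less_1)
  qed simp
  moreover have "c i' < B" using c[of i'] B by linarith
  \<comment> \<open>\<open>c\<close> counts from 0 and \<open>a\<close> from 1; since
    \<open>i' < l\<close>, the reduction modulo \<open>l\<close> changes nothing.\<close>
  moreover have "c i' = a i" using i by (simp add: c_def i')
  ultimately show "u B (q i) = a i" by (simp add: u_def)

  \<comment> \<open>Adding \<open>q i\<close> turns \<open>M\<close> into
    \<open>Suc M = B * n\<close>, a multiple of \<open>B\<close>. As \<open>i\<close> is positive,
    \<open>B ^ i * k\<close> also vanishes modulo \<open>B\<close>, leaving \<open>q i\<close> and
    \<open>r i\<close> congruent.\<close>
  have "B ^ i * k + q i = q i * Suc M + r i" using qr(1) by simp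
  then have "B * (B ^ i' * k) + q i = B * (q i * n) + r i"
    unfolding M(3) i' by (simp add: algebra_simps)
  then have "(B * (B ^ i' * k) + q i) mod B = (B * (q i * n) + r i) mod B"
    by (rule arg_cong)
  then show "u B (q i) = u B (r i)" by (simp add: u_def)
qed

end
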